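(* The following properties of a pair $(d,n)$ of positive integers are equivalent: (1) (Cutting property) $d = \lfloor n/k \rfloor$ for some integer $k$. (2) (Covering property) For the half-open unit interval $I_d = [d,d+1)$ of $\mathbb{R}$, there is some integer $k$ such that $k I_d$ covers $I_n$, i.e. $k[d,d+1) \supseteq [n,n+1)$. (3) (Intersection property) For the half-open unit interval $I_d = [d,d+1)$ of $\mathbb{R}$, there is some integer $k$ such that $k[d,d+1) \cap [n,n+1) \neq \emptyset$. (4) (Strong remainder property) There is a positive integer $k$ such that $n = dk + r$ where the remainder $r$ satisfies $0 \le r < \min(d,k)$. (5) (Tipping-point property) The strict inequality $\lfloor n/d \rfloor > \lfloor n/(d+1) \rfloor$ holds. (6) (Reciprocal-duality property) $d = \left\lfloor \dfrac{n}{\lfloor n/d \rfloor} \right\rfloor$.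
   Context: For a set $S \subseteq \mathbb{R}$ and an integer $k$, $kS = \{kx : x \in S\}$. In (1) the integer $k$ is nonzero so that $n/k$ is defined. Property (6) is understood to include that $\lfloor n/d \rfloor \ne 0$, so that the expression is defined; it is regarded as failing when $\lfloor n/d\rfloor = 0$. *)

theory Defs
  imports Complex_Main
begin

definition unit_interval :: "int \<Rightarrow> real set" where
  "unit_interval m = {real_of_int m ..< real_of_int m + 1}"

definition dilate :: "int \<Rightarrow> real set \<Rightarrow> real set" where
  "dilate k S = {real_of_int k * x | x. x \<in> S}"

definition cutting_property :: "int \<Rightarrow> int \<Rightarrow> bool" where
  "cutting_property d n \<longleftrightarrow>
     (\<exists>k::int. k \<noteq> 0 \<and> d = \<lfloor>real_of_int n / real_of_int k\<rfloor>)"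

definition covering_property :: "int \<Rightarrow> int \<Rightarrow> bool" where
  "covering_property d n \<longleftrightarrow>
     (\<exists>k::int. unit_interval n \<subseteq> dilate k (unit_interval d))"

definition intersection_property :: "int \<Rightarrow> int \<Rightarrow> bool" where
  "intersection_property d n \<longleftrightarrow>
     (\<exists>k::int. dilate k (unit_interval d) \<inter> unit_interval n \<noteq> {})"

definition strong_remainder_property :: "int \<Rightarrow> int \<Rightarrow> bool" where
  "strong_remainder_property d n \<longleftrightarrow>
     (\<exists>k r :: int. k > 0 \<and> n = d * k + r \<and> 0 \<le> r \<and> r < min d k)"

definition tipping_point_property :: "int \<Rightarrow> int \<Rightarrow> bool" where
  "tipping_point_property d n \<longleftrightarrow>
     \<lfloor>real_of_int n / real_of_int d\<rfloor> > \<lfloor>real_of_int n / real_of_int (d + 1)\<rfloor>"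

(* The inner floor is required to be nonzero, since x / 0 = 0 in HOL. *)
definition reciprocal_duality_property :: "int \<Rightarrow> int \<Rightarrow> bool" where
  "reciprocal_duality_property d n \<longleftrightarrow>
     \<lfloor>real_of_int n / real_of_int d\<rfloor> \<noteq> 0 \<and>
     d = \<lfloor>real_of_int n / real_of_int \<lfloor>real_of_int n / real_of_int d\<rfloor>\<rfloor>"

end

theory Submission
  imports Defs
begin

text \<open>
  For positive \<open>d\<close> and \<open>n\<close>, each of the six properties says that some integer \<open>k\<close> satisfies \<open>d * k \<le> n < (d + 1) * k\<close>, which
  means that the point \<open>n\<close> lies in the dilated interval \<open>[d * k, (d + 1) * k)\<close>.  Such a \<open>k\<close> is
  automatically positive, because the dilated interval must be nonempty.

  For cutting this is the characterisation of \<open>n div k = d\<close>.  For covering and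
  intersection it holds because the dilated interval has integer endpoints: if it meets \<open>[n, n + 1)\<close>
  at all, it contains the whole of it.

  The remaining three properties speak of the particular multiplier \<open>n div d\<close>.  They are equivalent
  to the others because \<open>n div d\<close> is the largest \<open>k\<close> with \<open>d * k \<le> n\<close>, while the second inequality
  \<open>n < (d + 1) * k\<close> only gets weaker as \<open>k\<close> grows.  Hence if any multiplier works, \<open>n div d\<close> works
  (lemma \<open>dilate_hits_iff_div\<close>).
\<close>

definition dilate_hits :: "int \<Rightarrow> int \<Rightarrow> int \<Rightarrow> bool" where
  "dilate_hits d n k \<longleftrightarrow> d * k \<le> n \<and> n < (d + 1) * k"

lemma dilate_hits_pos: "dilate_hits d n k \<Longrightarrow> k > 0"
  by (simp add: dilate_hits_def algebra_simps)

lemma dilate_hits_iff_div_eq: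
  assumes "k > 0"
  shows "dilate_hits d n k \<longleftrightarrow> n div k = d"
proof -
  have "n div k = d \<longleftrightarrow> \<lfloor>real_of_int n / real_of_int k\<rfloor> = d"
    by (simp add: floor_divide_of_int_eq)
  also have "\<dots> \<longleftrightarrow> real_of_int (d * k) \<le> real_of_int n \<and> real_of_int n < real_of_int ((d + 1) * k)"
    using assms by (simp add: floor_eq_iff field_simps)
  finally show ?thesis
    unfolding dilate_hits_def of_int_le_iff of_int_less_iff by blast
qed

text \<open>
  The largest admissible multiplier is always a witness, since enlarging \<open>k\<close> relaxes the upper
  bound \<open>n < (d + 1) * k\<close>.
\<close>
lemma dilate_hits_iff_div:
  assumes "d > 0"
  shows "(\<exists>k. dilate_hits d n k) \<longleftrightarrow> n < (d + 1) * (n div d)"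
proof
  assume "\<exists>k. dilate_hits d n k"
  then obtain k where k: "d * k \<le> n" "n < (d + 1) * k"
    by (auto simp: dilate_hits_def)
  have "k \<le> n div d"
    using k(1) assms zdiv_mono1[of "d * k" n d] by simp
  then have "(d + 1) * k \<le> (d + 1) * (n div d)"
    using assms by (intro mult_left_mono) auto
  with k(2) show "n < (d + 1) * (n div d)"
    by linarith
next
  assume "n < (d + 1) * (n div d)"
  moreover have "d * (n div d) \<le> n"
    using assms mult_div_mod_eq[of d n] pos_mod_sign[of d n] by linarith
  ultimately show "\<exists>k. dilate_hits d n k"
    by (auto simp: dilate_hits_def)
qed

lemma cutting_iff_dilate_hits:
  assumes "d > 0" and "n > 0"
  shows "cutting_property d n \<longleftrightarrow> (\<exists>k. dilate_hits d n k)"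
proof -
  \<comment> \<open>A negative \<open>k\<close> would make the quotient negative, so only positive cuts matter.\<close>
  have "k > 0" if "k \<noteq> 0" "d = n div k" for k
    using that assms neg_imp_zdiv_nonneg_iff[of k n] by force
  then have "cutting_property d n \<longleftrightarrow> (\<exists>k>0. n div k = d)"
    unfolding cutting_property_def floor_divide_of_int_eq by (metis less_irrefl)
  then show ?thesis
    using dilate_hits_iff_div_eq dilate_hits_pos by blast
qed

lemma dilate_unit_interval_pos:
  assumes "k > 0"
  shows "dilate k (unit_interval d) = {real_of_int (d * k) ..< real_of_int ((d + 1) * k)}"
proof (intro set_eqI iffI)
  fix y :: real
  assume "y \<in> {real_of_int (d * k) ..< real_of_int ((d + 1) * k)}"
  then have "y / real_of_int k \<in> unit_interval d" and "y = real_of_int k * (y / real_of_int k)"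
    using assms by (auto simp: unit_interval_def field_simps)
  then show "y \<in> dilate k (unit_interval d)"
    unfolding dilate_def by blast
next
  fix y :: real
  assume "y \<in> dilate k (unit_interval d)"
  then obtain x where "y = real_of_int k * x" "real_of_int d \<le> x" "x < real_of_int d + 1"
    by (auto simp: dilate_def unit_interval_def)
  moreover from this have "real_of_int k * real_of_int d \<le> real_of_int k * x"
    and "real_of_int k * x < real_of_int k * (real_of_int d + 1)"
    using assms by auto
  ultimately show "y \<in> {real_of_int (d * k) ..< real_of_int ((d + 1) * k)}"
    by (simp add: algebra_simps)
qed

lemma dilate_unit_interval_nonpos:
  assumes "k \<le> 0" and "d > 0" and "y \<in> dilate k (unit_interval d)"
  shows "y \<le> 0"
  using assms by (auto simp: dilate_def unit_interval_def intro!: mult_nonpos_nonneg)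

lemma dilate_hits_imp_covering:
  assumes "dilate_hits d n k"
  shows "unit_interval n \<subseteq> dilate k (unit_interval d)"
proof -
  have "real_of_int (d * k) \<le> real_of_int n" "real_of_int (n + 1) \<le> real_of_int ((d + 1) * k)"
    using assms by (simp_all only: of_int_le_iff dilate_hits_def zless_imp_add1_zle)
  then show ?thesis
    unfolding dilate_unit_interval_pos[OF dilate_hits_pos[OF assms]]
    by (auto simp: unit_interval_def)
qed

text \<open>
  Half-open intervals with integer endpoints are unions of the unit intervals \<open>[m, m + 1)\<close>, so
  meeting \<open>[n, n + 1)\<close> in any real point already forces the integer \<open>n\<close> into the dilated interval.
\<close>
lemma intersection_imp_dilate_hits:
  assumes "d > 0" and "n > 0"
    and "dilate k (unit_interval d) \<inter> unit_interval n \<noteq> {}"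
  shows "dilate_hits d n k"
proof -
  from assms(3) obtain y where y: "y \<in> dilate k (unit_interval d)"
    and n: "real_of_int n \<le> y" "y < real_of_int (n + 1)"
    by (auto simp: unit_interval_def)
  have "k > 0"
    using dilate_unit_interval_nonpos[OF _ \<open>d > 0\<close> y] n(1) \<open>n > 0\<close> by force
  from y have "real_of_int (d * k) \<le> y" "y < real_of_int ((d + 1) * k)"
    unfolding dilate_unit_interval_pos[OF \<open>k > 0\<close>] by simp_all
  with n have "real_of_int (d * k) < real_of_int (n + 1)"
    and "real_of_int n < real_of_int ((d + 1) * k)"
    by linarith+
  then have "d * k < n + 1" "n < (d + 1) * k"
    unfolding of_int_less_iff by simp_all
  then show ?thesis
    by (simp add: dilate_hits_def)
qed

lemma covering_imp_intersection: "covering_property d n \<Longrightarrow> intersection_property d n"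
proof -
  have "real_of_int n \<in> unit_interval n"
    by (simp add: unit_interval_def)
  then show "covering_property d n \<Longrightarrow> intersection_property d n"
    unfolding covering_property_def intersection_property_def by blast
qed

text \<open>
  The bounds \<open>0 \<le> r < k\<close> alone say that \<open>k\<close> is a multiplier.  The bound \<open>r < d\<close> adds that \<open>k = n div d\<close>,
  which costs nothing because this is the multiplier that works whenever one does.
\<close>
lemma strong_remainder_iff_dilate_hits:
  assumes "d > 0"
  shows "strong_remainder_property d n \<longleftrightarrow> (\<exists>k. dilate_hits d n k)"
proof
  assume "strong_remainder_property d n"
  then obtain k r where "n = d * k + r" "0 \<le> r" "r < k"
    by (auto simp: strong_remainder_property_def)
  then have "dilate_hits d n k"
    by (simp add: dilate_hits_def algebra_simps)
  then show "\<exists>k. dilate_hits d n k" ..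
next
  assume "\<exists>k. dilate_hits d n k"
  then have "n < (d + 1) * (n div d)"
    using dilate_hits_iff_div[OF assms] by blast
  moreover have n: "n = d * (n div d) + n mod d"
    by simp
  ultimately have "n mod d < n div d"
    unfolding distrib_right by linarith
  moreover have "0 \<le> n mod d" "n mod d < d"
    using assms by simp_all
  ultimately show "strong_remainder_property d n"
    unfolding strong_remainder_property_def
    using n by (intro exI[of _ "n div d"] exI[of _ "n mod d"]) linarith
qed

lemma tipping_point_iff_dilate_hits:
  assumes "d > 0"
  shows "tipping_point_property d n \<longleftrightarrow> (\<exists>k. dilate_hits d n k)"
proof -
  have "tipping_point_property d n \<longleftrightarrow> n div (d + 1) < n div d"
    unfolding tipping_point_property_def floor_divide_of_int_eq ..
  also have "\<dots> \<longleftrightarrow> real_of_int n < real_of_int ((d + 1) * (n div d))"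
    using assms
    by (simp add: floor_divide_of_int_eq[symmetric, where 'a = real and k = n and l = "d + 1"]
        floor_less_iff pos_divide_less_eq mult.commute del: of_int_add)
  finally have "tipping_point_property d n \<longleftrightarrow> n < (d + 1) * (n div d)"
    unfolding of_int_less_iff .
  then show ?thesis
    using dilate_hits_iff_div[OF assms] by simp
qed

lemma reciprocal_duality_iff_dilate_hits:
  assumes "d > 0" and "n > 0"
  shows "reciprocal_duality_property d n \<longleftrightarrow> (\<exists>k. dilate_hits d n k)"
proof -
  let ?q = "n div d"
  have "?q \<ge> 0"
    using assms by (simp add: pos_imp_zdiv_nonneg_iff)
  have lower: "d * ?q \<le> n"
    using assms(1) mult_div_mod_eq[of d n] pos_mod_sign[of d n] by linarith
  have "reciprocal_duality_property d n \<longleftrightarrow> ?q \<noteq> 0 \<and> d = n div ?q"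
    unfolding reciprocal_duality_property_def floor_divide_of_int_eq ..
  also have "\<dots> \<longleftrightarrow> dilate_hits d n ?q"
    using \<open>?q \<ge> 0\<close> dilate_hits_iff_div_eq[of ?q d n] dilate_hits_pos[of d n ?q]
    by (cases "?q = 0") auto
  also have "\<dots> \<longleftrightarrow> n < (d + 1) * ?q"
    using lower by (simp add: dilate_hits_def)
  finally show ?thesis
    using dilate_hits_iff_div[OF assms(1)] by simp
qed

theorem theorem3p1:
  fixes d n :: int
  assumes "d > 0" and "n > 0"
  shows "(cutting_property d n \<longleftrightarrow> covering_property d n) \<and>
         (covering_property d n \<longleftrightarrow> intersection_property d n) \<and>
         (intersection_property d n \<longleftrightarrow> strong_remainder_property d n) \<and>
         (strong_remainder_property d n \<longleftrightarrow> tipping_point_property d n) \<and>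
         (tipping_point_property d n \<longleftrightarrow> reciprocal_duality_property d n)"
proof -
  have covering: "covering_property d n" if "\<exists>k. dilate_hits d n k"
    using that dilate_hits_imp_covering unfolding covering_property_def by blast
  have intersection: "\<exists>k. dilate_hits d n k" if "intersection_property d n"
    using that intersection_imp_dilate_hits[OF assms] unfolding intersection_property_def by blast
  show ?thesis
    using covering intersection covering_imp_intersection[of d n]
      cutting_iff_dilate_hits[OF assms] strong_remainder_iff_dilate_hits[OF assms(1)]
      tipping_point_iff_dilate_hits[OF assms(1)] reciprocal_duality_iff_dilate_hits[OF assms]
    by blast
qed

end
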